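(* For every integer $k\ge 2$, the invariant $v_k:\mathscr{K}\to\mathbb{Q}$ is a Kauffman finite-type invariant of degree $k$, but it is not a GPV finite-type invariant of degree $\le n$ for any $n$. In particular, there is a fractional twist sequence $\Phi:\mathbb{Z}\to\mathscr{K}$ such that $v_k\circ\Phi$ is not a polynomial (of any degree) on $\mathbb{Z}$.
   Context: Long virtual knots: a long virtual knot diagram is a generic immersion $\mathbb{R}\to\mathbb{R}^2$, agreeing with the standard embedding of the $x$-axis outside a compact set, oriented along the positive $x$-direction, each double point marked as a classical over/under crossing or as a virtual crossing; $\mathscr{K}$ is the set of equivalence classes under Reidemeister and virtual moves. Each is encoded by a Gauss diagram: $\mathbb{R}$ with, for each classical crossing with preimages $x<y$, an arrow joining $x,y$ pointing right if the overcrossing is at $x$ and left if at $y$, labelled by the crossing's writhe sign. Jones–Kauffman polynomial: the Kauffman bracket $\langle\cdot\rangle$, with values in $\mathbb{Q}((A))$, is defined on unoriented long virtual diagrams possibly with additional closed components by: $\langle K\rangle = A\langle K_0\rangle + A^{-1}\langle K_\infty\rangle$ at a classical crossing (the two standard smoothings, $A$-smoothing and $A^{-1}$-smoothing), $\langle L\cup\bigcirc\rangle=(-A^2-A^{-2})\langle L\rangle$ for a closed component with no classical crossings, and $\langle\text{long component with no classical crossings}\rangle =1$. For an oriented long virtual knot $K$, $f_K(A)=(-A)^{-3w(K)}\langle|K|\rangle$, where $w(K)$ is the sum of the classical crossing signs. $v_k(K)$ denotes the coefficient of $x^k$ in the power series expansion of $f_K(e^x)$ about $x=0$. Finite type: an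 invariant $v$ is extended linearly; for a singular crossing $v(K_\times)=v(K_+)-v(K_-)$; for a semi-virtual crossing $v(K_{sv})=v(K_c)-v(K_{virt})$ (classical minus virtual crossing). $v$ is Kauffman finite-type of degree $\le n$ if it vanishes on all diagrams with $\ge n+1$ singular crossings, and of degree $n$ if it is of degree $\le n$ but not $\le n-1$; it is GPV finite-type of degree $\le n$ if it vanishes on all diagrams with $\ge n+1$ semi-virtual crossings. A function $f:\mathbb{Z}\to\mathbb{Q}$ is a polynomial of degree $\le n$ if all iterated differences $f(z+1)-f(z)$ of order $>n$ vanish. Fractional twist sequence: a proper pair in a Gauss diagram is a pair of disjoint open intervals $A<A'$ of $\mathbb{R}$ such that every arrow with an endpoint in $A\cup A'$ has one endpoint in each. Fix a Gauss diagram $G$ with a proper pair $(A,A')$ free of its endpoints, $Y\in\{S,B\}$ and $Z\in\{L,R\}$. $\Phi:\mathbb{Z}\to\mathscr{K}$ is a fractional twist sequence of type $FYZ$ if $\Phi(k)$ is $G$ together with $|k|$ arrows with endpoints $a_1<\dots<a_{|k|}$ in $A$, $b_1<\dots<b_{|k|}$ in $A'$, arrow $i$ joining $a_i$ to $b_i$ ($Y=S$) or to $b_{|k|+1-i}$ ($Y=B$), all pointing in direction $Z$ with sign $+$ when $k\ge0$, and all pointing opposite to $Z$ with sign $-$ when $k<0$. *)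

theory Defs
  imports "HOL-Analysis.Analysis"
begin

text \<open>An arrow is a triple (tail, head, sign) of two points of the real line and a writhe
  sign (True = +, False = -).  The tail is the preimage of the overcrossing, the head the
  preimage of the undercrossing (so the arrow points right iff the overcrossing is at the
  left preimage).  A Gauss diagram is a finite set of arrows with pairwise distinct endpoints.\<close>

type_synonym arrow = "real \<times> real \<times> bool"

definition arr_tail :: "arrow \<Rightarrow> real" where "arr_tail a = fst a"
definition arr_head :: "arrow \<Rightarrow> real" where "arr_head a = fst (snd a)"
definition arr_sign :: "arrow \<Rightarrow> bool" where "arr_sign a = snd (snd a)"

definition endpts :: "arrow set \<Rightarrow> real set" where
  "endpts G = (\<Union>a\<in>G. {arr_tail a, arr_head a})"

definition gauss_wf :: "arrow set \<Rightarrow> bool" where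
  "gauss_wf G \<longleftrightarrow> finite G \<and> (\<forall>a\<in>G. arr_tail a \<noteq> arr_head a) \<and>
     (\<forall>a\<in>G. \<forall>b\<in>G. a \<noteq> b \<longrightarrow> {arr_tail a, arr_head a} \<inter> {arr_tail b, arr_head b} = {})"

text \<open>Endpoints are numbered 1..2n from left to right; segment i (0 \<le> i \<le> 2n) of the line
  lies between endpoint i and endpoint i+1 (segments 0 and 2n are the unbounded ones).\<close>

definition rk :: "arrow set \<Rightarrow> real \<Rightarrow> nat" where
  "rk G x = card {y \<in> endpts G. y < x} + 1"

text \<open>A state is the set S of crossings receiving the A-smoothing (the others receive the
  A^{-1}-smoothing).  The A-smoothing of a positive crossing is the oriented (Seifert)
  smoothing, that of a negative crossing the unoriented one.  At a crossing with endpoint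
  numbers p < q the oriented smoothing joins segment p-1 to q and q-1 to p; the unoriented
  one joins p-1 to q-1 and p to q.\<close>

definition seg_edges :: "arrow set \<Rightarrow> arrow set \<Rightarrow> (nat \<times> nat) set" where
  "seg_edges G S = (\<Union>a\<in>G.
     let p = min (rk G (arr_tail a)) (rk G (arr_head a));
         q = max (rk G (arr_tail a)) (rk G (arr_head a))
     in if (a \<in> S \<longleftrightarrow> arr_sign a) then {(p - 1, q), (q - 1, p)}
        else {(p - 1, q - 1), (p, q)})"

definition n_components :: "arrow set \<Rightarrow> arrow set \<Rightarrow> nat" where
  "n_components G S = card ((\<lambda>i. {j. (i, j) \<in> (seg_edges G S \<union> (seg_edges G S)\<inverse>)\<^sup>*})
       ` {0..card (endpts G)})"

text \<open>Number of closed components of the smoothed diagram (the long component excluded).\<close>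
definition n_loops :: "arrow set \<Rightarrow> arrow set \<Rightarrow> nat" where
  "n_loops G S = n_components G S - 1"

definition kbracket :: "arrow set \<Rightarrow> real \<Rightarrow> real" where
  "kbracket G A = (\<Sum>S\<in>Pow G. A powi (int (card S) - int (card (G - S)))
                      * (- A\<^sup>2 - inverse (A\<^sup>2)) ^ n_loops G S)"

definition writhe :: "arrow set \<Rightarrow> int" where
  "writhe G = (\<Sum>a\<in>G. if arr_sign a then 1 else -1)"

definition jk_poly :: "arrow set \<Rightarrow> real \<Rightarrow> real" where
  "jk_poly G A = (- A) powi (- 3 * writhe G) * kbracket G A"

definition vk :: "nat \<Rightarrow> arrow set \<Rightarrow> real" where
  "vk k G = ((deriv ^^ k) (\<lambda>x. jk_poly G (exp x)) 0) / fact k"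

text \<open>Crossing change of the arrows in T: reverse direction and change sign.\<close>
definition flip :: "arrow set \<Rightarrow> arrow set \<Rightarrow> arrow set" where
  "flip T G = (G - T) \<union> (\<lambda>a. (arr_head a, arr_tail a, \<not> arr_sign a)) ` T"

text \<open>Singular crossings S: K_+ minus K_-, where K_- is obtained by a crossing change.\<close>
definition kauff_ft_le :: "(arrow set \<Rightarrow> real) \<Rightarrow> nat \<Rightarrow> bool" where
  "kauff_ft_le v n \<longleftrightarrow> (\<forall>G S. gauss_wf G \<longrightarrow> S \<subseteq> G \<longrightarrow> card S \<ge> n + 1 \<longrightarrow>
      (\<Sum>T\<in>Pow S. (-1) ^ card T * v (flip T G)) = 0)"

definition kauff_ft_deg :: "(arrow set \<Rightarrow> real) \<Rightarrow> nat \<Rightarrow> bool" where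
  "kauff_ft_deg v n \<longleftrightarrow> kauff_ft_le v n \<and> (n = 0 \<or> \<not> kauff_ft_le v (n - 1))"

text \<open>Semi-virtual crossings S: classical crossing minus virtual crossing (arrow removed).\<close>
definition gpv_ft_le :: "(arrow set \<Rightarrow> real) \<Rightarrow> nat \<Rightarrow> bool" where
  "gpv_ft_le v n \<longleftrightarrow> (\<forall>G S. gauss_wf G \<longrightarrow> S \<subseteq> G \<longrightarrow> card S \<ge> n + 1 \<longrightarrow>
      (\<Sum>T\<in>Pow S. (-1) ^ card T * v (G - T)) = 0)"

definition fdiff :: "(int \<Rightarrow> real) \<Rightarrow> int \<Rightarrow> real" where
  "fdiff f = (\<lambda>z. f (z + 1) - f z)"

definition poly_deg_le :: "(int \<Rightarrow> real) \<Rightarrow> nat \<Rightarrow> bool" where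
  "poly_deg_le f n \<longleftrightarrow> (\<forall>m>n. \<forall>z. (fdiff ^^ m) f z = 0)"

datatype twY = TwS | TwB
datatype twZ = TwL | TwR

definition proper_pair :: "arrow set \<Rightarrow> real set \<Rightarrow> real set \<Rightarrow> bool" where
  "proper_pair G A A' \<longleftrightarrow>
     (\<exists>\<alpha> \<beta> \<alpha>' \<beta>'. A = {\<alpha><..<\<beta>} \<and> A' = {\<alpha>'<..<\<beta>'} \<and> \<alpha> < \<beta> \<and> \<beta> \<le> \<alpha>' \<and> \<alpha>' < \<beta>') \<and>
     (\<forall>a\<in>G. {arr_tail a, arr_head a} \<inter> (A \<union> A') \<noteq> {} \<longrightarrow>
        ({arr_tail a, arr_head a} \<inter> A \<noteq> {} \<and> {arr_tail a, arr_head a} \<inter> A' \<noteq> {}))"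

definition twist_arrows ::
    "twY \<Rightarrow> twZ \<Rightarrow> bool \<Rightarrow> nat \<Rightarrow> (nat \<Rightarrow> real) \<Rightarrow> (nat \<Rightarrow> real) \<Rightarrow> arrow set" where
  "twist_arrows Y Z pos m a b =
     (\<lambda>i. let x = a i; y = b (if Y = TwS then i else m + 1 - i);
             pointsR = ((Z = TwR) \<longleftrightarrow> pos)
          in if pointsR then (x, y, pos) else (y, x, pos)) ` {1..m}"

definition frac_twist_seq :: "(int \<Rightarrow> arrow set) \<Rightarrow> bool" where
  "frac_twist_seq \<Phi> \<longleftrightarrow> (\<exists>G A A' Y Z. gauss_wf G \<and> proper_pair G A A' \<and>
      endpts G \<inter> (A \<union> A') = {} \<and>
      (\<forall>k. \<exists>a b. strict_mono_on {1..nat \<bar>k\<bar>} a \<and> strict_mono_on {1..nat \<bar>k\<bar>} b \<and>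
           a ` {1..nat \<bar>k\<bar>} \<subseteq> A \<and> b ` {1..nat \<bar>k\<bar>} \<subseteq> A' \<and>
           \<Phi> k = G \<union> twist_arrows Y Z (k \<ge> 0) (nat \<bar>k\<bar>) a b))"

end

theory Submission
  imports Defs
begin

text \<open>
  Indexing states by the set \<open>R\<close> of crossings that receive the oriented smoothing makes the number of
  loops independent of the crossing signs, and \<open>f\<^sub>K(e\<^sup>x)\<close> becomes a sum over \<open>R\<close> of products of local
  weights: \<open>- e\<close> to the power \<open>\<plusminus>2x\<close> (oriented) or \<open>\<plusminus>4x\<close> (unoriented).  A crossing change inverts
  the exponential, so each singular crossing contributes a factor divisible by \<open>x\<close>; hence degree at
  most \<open>k\<close>.

  Everything else comes from one family: \<open>m\<close> pairwise crossing positive arrows, all with their left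
  endpoints in one interval and their right endpoints, in the same order, in a second one.  The two
  strands then form a ladder, and smoothing with \<open>u\<close> unoriented smoothings leaves \<open>u - 1\<close> loops if
  \<open>u > 0\<close> and \<open>m mod 2\<close> loops if \<open>u = 0\<close>.  With \<open>d = - e\<^sup>2\<^sup>x - e\<^sup>-\<^sup>2\<^sup>x\<close> the state sum is evaluated by the
  binomial theorem: \<open>d f = e\<^sup>-\<^sup>6\<^sup>m\<^sup>x + (-1)\<^sup>m e\<^sup>-\<^sup>2\<^sup>m\<^sup>x (d\<^bsup>1 + m mod 2\<^esup> - 1)\<close>.  The same
  evaluation at leading order shows that making \<open>k\<close> such crossings singular gives
  \<open>\<plusminus>4\<^sup>k(3\<^sup>k - 3)/2\<close>, so the degree is exactly \<open>k\<close>.  The coefficients at \<open>x\<^sup>k\<close> for even and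
  for odd \<open>m\<close> are two polynomials in \<open>m\<close>, whose difference has leading coefficient proportional to
  the \<open>x\<^sup>2\<close>-coefficient of \<open>(d + 2)(d - 1) / d\<close>, which is nonzero; so they are not given by
  a single polynomial.  Polynomiality would follow from vanishing iterated differences by Newton's
  forward formula, and those differences are exactly the alternating sums over semi-virtual crossings.
\<close>

lemma higher_deriv_fps_expansion_real:
  fixes f :: "real \<Rightarrow> real"
  assumes "f has_fps_expansion F"
  shows "(deriv ^^ n) f 0 = fact n * fps_nth F n"
  using assms
proof (induction n arbitrary: f F)
  case 0
  then show ?case by (auto simp: has_fps_expansion_def eval_fps_at_0 dest: eventually_nhds_x_imp_x)
next
  case (Suc n)
  have "(deriv ^^ Suc n) f 0 = (deriv ^^ n) (deriv f) 0"
    by (simp add: funpow_Suc_right del: funpow.simps)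
  also have "\<dots> = fact n * fps_nth (fps_deriv F) n"
    by (rule Suc.IH[OF has_fps_expansion_deriv[OF Suc.prems]])
  finally show ?case by (simp add: algebra_simps)
qed

section \<open>The state sum as a formal power series\<close>

text \<open>\<open>R\<close> is the set of crossings with oriented smoothing, not the state in the sense of \<open>n_loops\<close>.\<close>
definition loops :: "arrow set \<Rightarrow> arrow set \<Rightarrow> nat" where
  "loops G R = n_loops G {a \<in> G. a \<in> R \<longleftrightarrow> arr_sign a}"

text \<open>The weight of a crossing of sign \<open>s\<close> is \<open>(-A)\<^sup>-\<^sup>3\<^sup>s\<close> from the writhe times \<open>A\<^sup>\<plusminus>\<^sup>1\<close> from the bracket;
  \<open>r\<close> says whether the smoothing is oriented.\<close>
definition wt_exponent :: "bool \<Rightarrow> bool \<Rightarrow> real" where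
  "wt_exponent s r = (if s then -1 else 1) * (if r then 2 else 4)"

definition wt :: "bool \<Rightarrow> bool \<Rightarrow> real fps" where
  "wt s r = - fps_exp (wt_exponent s r)"

definition loop_val :: "real fps" where
  "loop_val = - fps_exp 2 - fps_exp (-2)"

definition jk_series :: "arrow set \<Rightarrow> real fps" where
  "jk_series G = (\<Sum>R\<in>Pow G. (\<Prod>a\<in>G. wt (arr_sign a) (a \<in> R)) * loop_val ^ loops G R)"

lemma powi_sum:
  fixes A :: real
  assumes "A \<noteq> 0" "finite I"
  shows "A powi (\<Sum>i\<in>I. f i) = (\<Prod>i\<in>I. A powi f i)"
  using assms(2) by induction (use assms(1) in \<open>auto simp: power_int_add\<close>)

lemma jk_poly_exp:
  assumes "finite G"
  shows "jk_poly G (exp x) = (\<Sum>R\<in>Pow G.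
    (\<Prod>a\<in>G. - exp (wt_exponent (arr_sign a) (a \<in> R) * x)) * (- exp (2 * x) - exp (- 2 * x)) ^ loops G R)"
proof -
  let ?A = "exp x"
  let ?M = "\<lambda>R. {a \<in> G. a \<in> R \<longleftrightarrow> arr_sign a}"
  have d: "- ?A\<^sup>2 - inverse (?A\<^sup>2) = - exp (2 * x) - exp (- 2 * x)"
    by (simp add: exp_double[symmetric] exp_minus)
  have w: "(- ?A) powi (- 3 * writhe G) = (\<Prod>a\<in>G. (- ?A) powi (if arr_sign a then -3 else 3))"
  proof -
    have "- 3 * writhe G = (\<Sum>a\<in>G. if arr_sign a then -3 else 3)"
      unfolding writhe_def sum_distrib_left by (intro sum.cong) auto
    then show ?thesis using assms by (simp add: powi_sum)
  qed
  have s: "?A powi (int (card S) - int (card (G - S))) = (\<Prod>a\<in>G. ?A powi (if a \<in> S then 1 else -1))"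
    if "S \<subseteq> G" for S
  proof -
    have "(\<Sum>a\<in>G. if a \<in> S then 1 else -1 :: int) = (\<Sum>a\<in>S. 1) + (\<Sum>a\<in>G - S. -1)"
      using that assms by (subst sum.subset_diff[of S G]) (auto intro: sum.cong)
    then have "int (card S) - int (card (G - S)) = (\<Sum>a\<in>G. if a \<in> S then 1 else -1)" by simp
    then show ?thesis using assms by (simp add: powi_sum del: of_nat_diff)
  qed
  have c: "(- ?A) powi (if arr_sign a then -3 else 3) * ?A powi (if a \<in> ?M R then 1 else -1)
      = - exp (wt_exponent (arr_sign a) (a \<in> R) * x)" if "a \<in> G" for a R
    using that
    by (auto simp: wt_exponent_def power_int_minus exp_minus field_simps
        power_minus_odd simp flip: exp_of_nat_mult exp_add)
  \<comment> \<open>Passing between \<open>A\<close>-smoothed crossings and oriented smoothings is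
    an involution on subsets of \<open>G\<close>, so \<open>?M\<close> is its own inverse.\<close>
  have bij: "bij_betw ?M (Pow G) (Pow G)"
    by (rule bij_betwI[of _ _ _ ?M]) auto
  have "jk_poly G ?A = (\<Sum>S\<in>Pow G. (\<Prod>a\<in>G. (- ?A) powi (if arr_sign a then -3 else 3) *
      ?A powi (if a \<in> S then 1 else -1)) * (- exp (2 * x) - exp (- 2 * x)) ^ n_loops G S)"
    unfolding jk_poly_def kbracket_def d w sum_distrib_left
    by (rule sum.cong) (simp_all only: s Pow_iff prod.distrib mult.assoc)
  also have "\<dots> = (\<Sum>R\<in>Pow G. (\<Prod>a\<in>G. (- ?A) powi (if arr_sign a then -3 else 3) *
      ?A powi (if a \<in> ?M R then 1 else -1)) * (- exp (2 * x) - exp (- 2 * x)) ^ n_loops G (?M R))"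
    by (rule sum.reindex_bij_betw[OF bij, symmetric])
  also have "\<dots> = (\<Sum>R\<in>Pow G. (\<Prod>a\<in>G. - exp (wt_exponent (arr_sign a) (a \<in> R) * x)) *
      (- exp (2 * x) - exp (- 2 * x)) ^ loops G R)"
    unfolding loops_def by (intro sum.cong refl arg_cong2[where f="(*)"] prod.cong c)
  finally show ?thesis .
qed

lemma has_fps_expansion_power_real:
  fixes f :: "real \<Rightarrow> real"
  assumes "f has_fps_expansion F"
  shows "(\<lambda>x. f x ^ n) has_fps_expansion F ^ n"
  using assms by (induction n) (auto intro!: fps_expansion_intros)

lemma vk_eq_jk_series:
  assumes "finite G"
  shows "vk k G = fps_nth (jk_series G) k"
proof -
  have "(\<lambda>x. jk_poly G (exp x)) has_fps_expansion jk_series G"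
    unfolding jk_poly_exp[OF assms] jk_series_def wt_def loop_val_def
    by (intro has_fps_expansion_sum has_fps_expansion_mult has_fps_expansion_prod
        has_fps_expansion_minus has_fps_expansion_power_real has_fps_expansion_exp has_fps_expansion_diff)
  then show ?thesis
    unfolding vk_def by (simp add: higher_deriv_fps_expansion_real)
qed

section \<open>Crossing changes\<close>

definition switch_arrow :: "arrow set \<Rightarrow> arrow \<Rightarrow> arrow" where
  "switch_arrow T a = (if a \<in> T then (arr_head a, arr_tail a, \<not> arr_sign a) else a)"

lemma flip_conv_image: "T \<subseteq> G \<Longrightarrow> flip T G = switch_arrow T ` G"
  unfolding flip_def switch_arrow_def by (auto simp: image_iff)

lemma arr_sign_switch_arrow: "arr_sign (switch_arrow T a) \<longleftrightarrow> (arr_sign a \<longleftrightarrow> a \<notin> T)"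
  by (auto simp: switch_arrow_def arr_sign_def)

lemma endpoints_switch_arrow:
  "{arr_tail (switch_arrow T a), arr_head (switch_arrow T a)} = {arr_tail a, arr_head a}"
  by (auto simp: switch_arrow_def arr_tail_def arr_head_def)

text \<open>Switching preserves the endpoint set of an arrow, and in a well-formed diagram distinct
  arrows have disjoint nonempty endpoint sets.\<close>

lemma inj_on_switch_arrow:
  assumes "gauss_wf G"
  shows "inj_on (switch_arrow T) G"
proof (rule inj_onI, rule ccontr)
  fix a b assume "a \<in> G" "b \<in> G" "switch_arrow T a = switch_arrow T b" "a \<noteq> b"
  then show False
    using assms endpoints_switch_arrow[of T a] endpoints_switch_arrow[of T b]
    unfolding gauss_wf_def by (metis Int_absorb insert_not_empty)
qed

text \<open>The share of one arrow in \<open>seg_edges\<close>. With the kind of smoothing as a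
  flag, only the unordered pair of endpoints matters, not sign or direction.\<close>

definition smoothing_edges :: "(real \<Rightarrow> nat) \<Rightarrow> arrow \<Rightarrow> bool \<Rightarrow> (nat \<times> nat) set" where
  "smoothing_edges r a oriented = (
     let p = min (r (arr_tail a)) (r (arr_head a)); q = max (r (arr_tail a)) (r (arr_head a))
     in if oriented then {(p - 1, q), (q - 1, p)} else {(p - 1, q - 1), (p, q)})"

lemma seg_edges_oriented:
  "seg_edges G {a \<in> G. a \<in> R \<longleftrightarrow> arr_sign a} = (\<Union>a\<in>G. smoothing_edges (rk G) a (a \<in> R))"
  unfolding seg_edges_def smoothing_edges_def Let_def by (intro SUP_cong) auto

lemma smoothing_edges_switch_arrow:
  "smoothing_edges r (switch_arrow T a) = smoothing_edges r a"
  by (auto simp: fun_eq_iff smoothing_edges_def switch_arrow_def arr_tail_def arr_head_def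
      min.commute max.commute)

lemma endpts_switch_arrow: "endpts (switch_arrow T ` G) = endpts G"
  unfolding endpts_def by (simp only: image_image endpoints_switch_arrow)

lemma loops_switch_arrow:
  assumes "gauss_wf G" "R \<subseteq> G"
  shows "loops (switch_arrow T ` G) (switch_arrow T ` R) = loops G R"
proof -
  have "switch_arrow T a \<in> switch_arrow T ` R \<longleftrightarrow> a \<in> R" if "a \<in> G" for a
    using inj_on_image_mem_iff[OF inj_on_switch_arrow[OF assms(1)] that assms(2)] .
  moreover have "rk (switch_arrow T ` G) = rk G"
    by (simp add: fun_eq_iff rk_def endpts_switch_arrow)
  ultimately show ?thesis
    unfolding loops_def n_loops_def n_components_def seg_edges_oriented
    by (simp add: endpts_switch_arrow smoothing_edges_switch_arrow cong: SUP_cong)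
qed

text \<open>Pulling states back along \<open>switch_arrow T\<close> puts all crossing changes over
  the common index set \<open>Pow G\<close>; only the weights still depend on
  \<open>T\<close>.\<close>

lemma jk_series_flip:
  assumes wf: "gauss_wf G" and "T \<subseteq> G"
  shows "jk_series (flip T G) = (\<Sum>R\<in>Pow G.
    (\<Prod>a\<in>G. wt (arr_sign a \<longleftrightarrow> a \<notin> T) (a \<in> R)) * loop_val ^ loops G R)"
proof -
  let ?f = "switch_arrow T"
  have inj: "inj_on ?f G" by (rule inj_on_switch_arrow[OF wf])
  have "jk_series (flip T G) = (\<Sum>R\<in>Pow (?f ` G).
      (\<Prod>a\<in>?f ` G. wt (arr_sign a) (a \<in> R)) * loop_val ^ loops (?f ` G) R)"
    unfolding jk_series_def flip_conv_image[OF assms(2)] ..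
  also have "\<dots> = (\<Sum>R\<in>Pow G.
      (\<Prod>a\<in>?f ` G. wt (arr_sign a) (a \<in> ?f ` R)) * loop_val ^ loops (?f ` G) (?f ` R))"
    by (rule sum.reindex_bij_betw[OF bij_betw_Pow[OF inj_on_imp_bij_betw[OF inj]], symmetric])
  also have "\<dots> = (\<Sum>R\<in>Pow G. (\<Prod>a\<in>G. wt (arr_sign a \<longleftrightarrow> a \<notin> T) (a \<in> R)) * loop_val ^ loops G R)"
    by (intro sum.cong refl arg_cong2[where f="(*)"])
      (auto simp: prod.reindex[OF inj] arr_sign_switch_arrow loops_switch_arrow[OF wf]
        inj_on_image_mem_iff[OF inj] intro!: prod.cong)
  finally show ?thesis .
qed

text \<open>All weights have constant term -1, so their differences are divisible by
  \<open>fps_X\<close> and the shift is an exact quotient.\<close>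

definition jump_quot :: "bool \<Rightarrow> bool \<Rightarrow> real fps" where
  "jump_quot s r = fps_shift 1 (wt s r - wt (\<not> s) r)"

lemma wt_diff: "wt s r - wt (\<not> s) r = fps_X * jump_quot s r"
  unfolding jump_quot_def
  by (rule fps_ext) (simp add: wt_def fps_X_mult_nth)

definition alt_quot :: "arrow set \<Rightarrow> arrow set \<Rightarrow> real fps" where
  "alt_quot G S = (\<Sum>R\<in>Pow G. (\<Prod>a\<in>S. jump_quot (arr_sign a) (a \<in> R)) *
     (\<Prod>a\<in>G - S. wt (arr_sign a) (a \<in> R)) * loop_val ^ loops G R)"

text \<open>For fixed \<open>R\<close>, the sum over \<open>T\<close> is the expansion of a product
  over \<open>S\<close> of weight differences, each of which supplies one factor
  \<open>fps_X\<close>.\<close>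

lemma jk_series_alternating_sum:
  assumes wf: "gauss_wf G" and SG: "S \<subseteq> G"
  shows "(\<Sum>T\<in>Pow S. (-1) ^ card T * jk_series (flip T G)) = fps_X ^ card S * alt_quot G S"
proof -
  have fin: "finite G" "finite S" using wf SG finite_subset by (auto simp: gauss_wf_def)
  let ?w = "\<lambda>T R a. wt (arr_sign a \<longleftrightarrow> a \<notin> T) (a \<in> R)"
  have split: "(\<Prod>a\<in>G. ?w T R a) = (\<Prod>a\<in>T. wt (\<not> arr_sign a) (a \<in> R)) * (\<Prod>a\<in>S - T. wt (arr_sign a) (a \<in> R))
      * (\<Prod>a\<in>G - S. wt (arr_sign a) (a \<in> R))" if "T \<subseteq> S" for T R
  proof -
    have "(\<Prod>a\<in>G. ?w T R a) = (\<Prod>a\<in>G - S. ?w T R a) * ((\<Prod>a\<in>S - T. ?w T R a) * (\<Prod>a\<in>T. ?w T R a))"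
      using prod.subset_diff[OF SG fin(1), of "?w T R"] prod.subset_diff[OF that fin(2), of "?w T R"]
      by simp
    moreover have "(\<Prod>a\<in>G - S. ?w T R a) = (\<Prod>a\<in>G - S. wt (arr_sign a) (a \<in> R))"
      "(\<Prod>a\<in>S - T. ?w T R a) = (\<Prod>a\<in>S - T. wt (arr_sign a) (a \<in> R))"
      "(\<Prod>a\<in>T. ?w T R a) = (\<Prod>a\<in>T. wt (\<not> arr_sign a) (a \<in> R))"
      using that by (auto intro!: prod.cong arg_cong2[where f=wt])
    ultimately show ?thesis by (simp add: mult_ac)
  qed
  have "(\<Sum>T\<in>Pow S. (-1) ^ card T * jk_series (flip T G)) =
     (\<Sum>T\<in>Pow S. (-1) ^ card T * (\<Sum>R\<in>Pow G. (\<Prod>a\<in>G. ?w T R a) * loop_val ^ loops G R))"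
    using SG by (intro sum.cong refl) (auto simp: jk_series_flip[OF wf])
  also have "\<dots> = (\<Sum>R\<in>Pow G. (\<Sum>T\<in>Pow S. (-1) ^ card T * (\<Prod>a\<in>G. ?w T R a)) * loop_val ^ loops G R)"
    unfolding sum_distrib_left sum_distrib_right by (subst sum.swap) (simp add: mult.assoc)
  also have "\<dots> = (\<Sum>R\<in>Pow G. (\<Prod>a\<in>S. wt (arr_sign a) (a \<in> R) - wt (\<not> arr_sign a) (a \<in> R)) *
      (\<Prod>a\<in>G - S. wt (arr_sign a) (a \<in> R)) * loop_val ^ loops G R)"
    unfolding prod_diff_conv_sum[OF fin(2)] sum_distrib_right
    by (intro sum.cong refl) (auto simp: split mult.assoc)
  also have "\<dots> = fps_X ^ card S * alt_quot G S"
    unfolding alt_quot_def wt_diff prod.distrib prod_constant sum_distrib_left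
    by (simp add: mult.assoc)
  finally show ?thesis .
qed

lemma vk_alternating_sum:
  assumes wf: "gauss_wf G" and SG: "S \<subseteq> G"
  shows "(\<Sum>T\<in>Pow S. (-1) ^ card T * vk k (flip T G)) =
    (if k < card S then 0 else fps_nth (alt_quot G S) (k - card S))"
proof -
  have fin: "finite (flip T G)" if "T \<in> Pow S" for T
    using wf SG that finite_subset[of T G] by (auto simp: gauss_wf_def flip_def)
  have "(-1) ^ n * fps_nth F k = fps_nth ((-1) ^ n * F) k" for n and F :: "real fps"
    by (cases "even n") auto
  then have "(\<Sum>T\<in>Pow S. (-1) ^ card T * vk k (flip T G)) =
      fps_nth (\<Sum>T\<in>Pow S. (-1) ^ card T * jk_series (flip T G)) k"
    by (simp add: vk_eq_jk_series fin fps_sum_nth)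
  then show ?thesis
    by (simp add: jk_series_alternating_sum[OF assms] fps_X_power_mult_nth)
qed

section \<open>Loops of parallel twists\<close>

text \<open>The counting function is strictly increasing on \<open>I\<close>, hence injective, and a
  comparison of cardinalities makes it onto. It numbers \<open>I\<close> in increasing
  order.\<close>

lemma bij_betw_card_le:
  fixes I :: "'a::linorder set"
  assumes "finite I"
  shows "bij_betw (\<lambda>x. card {y \<in> I. y \<le> x}) I {1..card I}"
proof -
  let ?f = "\<lambda>x. card {y \<in> I. y \<le> x}"
  have less: "?f x < ?f z" if "x \<in> I" "z \<in> I" "x < z" for x z
  proof (rule psubset_card_mono)
    have "{y \<in> I. y \<le> x} \<subseteq> {y \<in> I. y \<le> z}" using that(3) by auto
    moreover have "z \<in> {y \<in> I. y \<le> z}" "z \<notin> {y \<in> I. y \<le> x}" using that by auto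
    ultimately show "{y \<in> I. y \<le> x} \<subset> {y \<in> I. y \<le> z}" by blast
  qed (use assms in simp)
  have inj: "inj_on ?f I"
  proof (rule inj_onI)
    fix x z assume "x \<in> I" "z \<in> I" "?f x = ?f z"
    then show "x = z" using less[of x z] less[of z x] by (cases x z rule: linorder_cases) simp_all
  qed
  have "?f x \<in> {1..card I}" if "x \<in> I" for x
  proof -
    have "?f x \<le> card I" using assms by (intro card_mono) auto
    moreover have "x \<in> {y \<in> I. y \<le> x}" using that by simp
    then have "?f x > 0" using assms by (subst card_gt_0_iff) auto
    ultimately show ?thesis by simp
  qed
  then have "?f ` I \<subseteq> {1..card I}" by blast
  then have "?f ` I = {1..card I}"
    by (intro card_subset_eq) (auto simp: card_image[OF inj])
  with inj show ?thesis by (simp add: bij_betw_def)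
qed

lemma card_image_eq_if_same_kernel:
  assumes "\<And>x y. x \<in> V \<Longrightarrow> y \<in> V \<Longrightarrow> f x = f y \<longleftrightarrow> g x = g y"
  shows "card (f ` V) = card (g ` V)"
proof -
  let ?h = "\<lambda>z. f (inv_into V g z)"
  have h: "?h (g x) = f x" if "x \<in> V" for x
    using that assms[of "inv_into V g (g x)" x] by (simp add: inv_into_into f_inv_into_f)
  have "inj_on ?h (g ` V)"
  proof (rule inj_onI)
    fix y z assume "y \<in> g ` V" "z \<in> g ` V" and eq: "?h y = ?h z"
    then obtain u v where "u \<in> V" "y = g u" "v \<in> V" "z = g v" by blast
    with eq h[of u] h[of v] assms[of u v] show "y = z" by metis
  qed
  then have "card (?h ` g ` V) = card (g ` V)" by (rule card_image)
  moreover have "?h ` g ` V = f ` V"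
    unfolding image_image by (rule image_cong[OF refl h])
  ultimately show ?thesis by simp
qed

section \<open>Counting graph components by colourings\<close>

definition component :: "('a \<times> 'a) set \<Rightarrow> 'a \<Rightarrow> 'a set" where
  "component E i = {j. (i, j) \<in> (E \<union> E\<inverse>)\<^sup>*}"

lemma component_eqI:
  assumes "(x, y) \<in> E"
  shows "component E x = component E y"
proof -
  let ?R = "E \<union> E\<inverse>"
  have sub: "component E v \<subseteq> component E u" if "(u, v) \<in> ?R" for u v
    unfolding component_def using converse_rtrancl_into_rtrancl[OF that] by (intro Collect_mono impI)
  have "(x, y) \<in> ?R" "(y, x) \<in> ?R" using assms by simp_all
  then show ?thesis using sub by (intro subset_antisym)
qed

lemma n_components_component:
  "n_components G S = card (component (seg_edges G S) ` {0..card (endpts G)})"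
  unfolding n_components_def component_def[abs_def] ..

text \<open>By \<open>edge\<close>, different colours lie in different components; by
  \<open>conn\<close>, equal colours lie in the same one. So components correspond to
  colours.\<close>

lemma card_components_eq:
  assumes edge: "\<And>x y. (x, y) \<in> E \<Longrightarrow> c x = c y"
    and conn: "\<And>x y. x \<in> V \<Longrightarrow> y \<in> V \<Longrightarrow> c x = c y \<Longrightarrow> component E x = component E y"
  shows "card (component E ` V) = card (c ` V)"
proof (rule card_image_eq_if_same_kernel)
  fix x y assume xy: "x \<in> V" "y \<in> V"
  have const: "c u = c v" if "(u, v) \<in> (E \<union> E\<inverse>)\<^sup>*" for u v
    using that
  proof induction
    case (step v w)
    then have "c v = c w" using edge[of v w] edge[of w v] by auto
    with step.IH show ?case by simp
  qed simp
  have "c x = c y" if "component E x = component E y"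
  proof -
    have "y \<in> component E x" using that by (simp add: component_def)
    then show ?thesis using const by (simp add: component_def)
  qed
  then show "component E x = component E y \<longleftrightarrow> c x = c y" using conn[OF xy] by blast
qed

text \<open>Segments \<open>l\<close> and \<open>m + l\<close> are the two strands at level \<open>l \<le> m\<close>; segment \<open>m\<close> is both the top of the
  first strand and the bottom of the second.  \<open>U\<close> lists the unoriented smoothings.\<close>
definition rung :: "nat \<Rightarrow> nat \<Rightarrow> bool \<Rightarrow> (nat \<times> nat) set" where
  "rung m i oriented = (if oriented then {(i - 1, m + i), (m + i - 1, i)}
     else {(i - 1, m + i - 1), (i, m + i)})"

definition ladder :: "nat \<Rightarrow> nat set \<Rightarrow> (nat \<times> nat) set" where
  "ladder m U = (\<Union>i\<in>{1..m}. rung m i (i \<notin> U))"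

text \<open>An oriented rung leads from each strand to the other one level up. Indexing by the lower
  level \<open>l\<close> avoids truncated subtraction.\<close>

lemma ladder_swap:
  assumes "l < m" "Suc l \<notin> U"
  shows "component (ladder m U) (m + Suc l) = component (ladder m U) l"
    and "component (ladder m U) (m + l) = component (ladder m U) (Suc l)"
proof -
  have "Suc l \<in> {1..m}" "(l, m + Suc l) \<in> rung m (Suc l) (Suc l \<notin> U)"
    "(m + l, Suc l) \<in> rung m (Suc l) (Suc l \<notin> U)"
    using assms by (auto simp: rung_def)
  then have edges: "(l, m + Suc l) \<in> ladder m U" "(m + l, Suc l) \<in> ladder m U"
    unfolding ladder_def by blast+
  show "component (ladder m U) (m + Suc l) = component (ladder m U) l"
    by (rule component_eqI[OF edges(1), symmetric])
  show "component (ladder m U) (m + l) = component (ladder m U) (Suc l)"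
    by (rule component_eqI[OF edges(2)])
qed

lemma ladder_cap:
  assumes "l < m" "Suc l \<in> U"
  shows "component (ladder m U) (m + l) = component (ladder m U) l"
    and "component (ladder m U) (m + Suc l) = component (ladder m U) (Suc l)"
proof -
  have "Suc l \<in> {1..m}" "(l, m + l) \<in> rung m (Suc l) (Suc l \<notin> U)"
    "(Suc l, m + Suc l) \<in> rung m (Suc l) (Suc l \<notin> U)"
    using assms by (auto simp: rung_def)
  then have edges: "(l, m + l) \<in> ladder m U" "(Suc l, m + Suc l) \<in> ladder m U"
    unfolding ladder_def by blast+
  show "component (ladder m U) (m + l) = component (ladder m U) l"
    by (rule component_eqI[OF edges(1), symmetric])
  show "component (ladder m U) (m + Suc l) = component (ladder m U) (Suc l)"
    by (rule component_eqI[OF edges(2), symmetric])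
qed

text \<open>Two swaps lead two levels up the same strand, so at most two classes remain. For odd
  \<open>m\<close> the parity of the segment number separates them; for even \<open>m > 0\<close>
  segment \<open>m\<close>, as bottom of the second strand, is joined to segment 1 and merges
  them.\<close>

lemma ladder_components_swaps:
  "card (component (ladder m {}) ` {0..2 * m}) = 1 + m mod 2"
proof -
  let ?c = "\<lambda>s. if odd m then s mod 2 else 0"
  let ?K = "component (ladder m {})"
  have low: "?K s = ?K (s mod 2)" if "s \<le> m" for s
    using that
  proof (induction s rule: less_induct)
    case (less s)
    show ?case
    proof (cases "s < 2")
      case False
      then obtain l where l: "s = Suc (Suc l)" using that[of "s - 2"] by simp
      have "?K (m + Suc l) = ?K l" "?K (m + Suc l) = ?K s"
        using less.prems ladder_swap[of l m "{}"] ladder_swap[of "Suc l" m "{}"] l by auto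
      moreover have "?K l = ?K (l mod 2)" by (rule less.IH) (use less.prems l in simp_all)
      moreover have "s mod 2 = l mod 2" by (simp add: l)
      ultimately show ?thesis by metis
    qed simp
  qed
  have canonical: "?K s = ?K (?c s)" if s: "s \<le> 2 * m" for s
  proof -
    have even: "?K (t mod 2) = ?K 0" if "even m" "m > 0" for t
    proof -
      have "?K m = ?K 1" using ladder_swap(2)[of 0 m "{}"] that by simp
      moreover have "?K m = ?K 0" using low[of m] that by (auto elim: evenE)
      moreover have "t mod 2 = 0 \<or> t mod 2 = 1" by presburger
      ultimately show ?thesis by metis
    qed
    obtain t where t: "?K s = ?K t" "t \<le> m" "odd m \<longrightarrow> t mod 2 = s mod 2"
    proof (cases "s \<le> m")
      case False
      define l where "l = s - Suc m"
      have l: "s = m + Suc l" "l < m" using False s by (auto simp: l_def)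
      then have "?K s = ?K l" using ladder_swap(1)[of l m "{}"] by simp
      moreover have "l mod 2 = s mod 2" if "odd m"
        using that unfolding l(1) by (simp add: mod_2_eq_odd)
      ultimately show ?thesis using that[of l] l by auto
    qed (use that in auto)
    have Ks: "?K s = ?K (t mod 2)" using t(1) low[OF t(2)] by (rule trans)
    show ?thesis
    proof (cases "odd m")
      case True
      then show ?thesis using Ks t(3) by simp
    next
      case False
      then show ?thesis using Ks even[of t] s by (cases "m = 0") simp_all
    qed
  qed
  have "card (?K ` {0..2 * m}) = card (?c ` {0..2 * m})"
  proof (rule card_components_eq)
    fix x y assume "(x, y) \<in> ladder m {}"
    then obtain i where i: "i \<in> {1..m}" "(x = i - 1 \<and> y = m + i) \<or> (x = m + i - 1 \<and> y = i)"
      by (auto simp: ladder_def rung_def)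
    then obtain l where l: "i = Suc l" by (cases i) auto
    have "l mod 2 = (m + Suc l) mod 2 \<and> (m + l) mod 2 = Suc l mod 2" if "odd m"
      using that by (simp add: mod_2_eq_odd)
    moreover have "x = l \<and> y = m + Suc l \<or> x = m + l \<and> y = Suc l" using i l by simp
    ultimately show "?c x = ?c y" by (cases "odd m") auto
  next
    fix x y assume xy: "x \<in> {0..2 * m}" "y \<in> {0..2 * m}" and eq: "?c x = ?c y"
    have "?K x = ?K (?c x)" by (rule canonical) (use xy in simp)
    also have "\<dots> = ?K (?c y)" by (simp only: eq)
    also have "\<dots> = ?K y" by (rule canonical[symmetric]) (use xy in simp)
    finally show "?K x = ?K y" .
  qed
  also have "?c ` {0..2 * m} = (if odd m then {0, 1} else {0})"
  proof (cases "odd m")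
    case True
    then have "0 \<in> {0..2 * m}" "1 \<in> {0..2 * m}" by (auto simp: Suc_le_eq odd_pos)
    then have "0 mod 2 \<in> (\<lambda>s. s mod 2) ` {0..2 * m}" "1 mod 2 \<in> (\<lambda>s. s mod 2) ` {0..2 * m}"
      by (blast intro: imageI)+
    then show ?thesis using True by auto
  qed auto
  finally show ?thesis by (simp add: odd_iff_mod_2_eq_one)
qed

text \<open>One cap joins the strands at its level and the other rungs carry this to every level, so
  components are determined by levels. Neighbouring levels merge unless a cap lies between
  them.\<close>

lemma ladder_components_caps:
  assumes U: "U \<subseteq> {1..m}" "U \<noteq> {}"
  shows "card (component (ladder m U) ` {0..2 * m}) = card U"
proof -
  let ?K = "component (ladder m U)"
  define n where "n l = card {u \<in> U. u \<le> l}" for l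
  define r where "r = card U"
  \<comment> \<open>The caps cut the levels into \<open>r + 1\<close> blocks, of which segment \<open>m\<close> glues the first to the last.\<close>
  define c where "c s = n (if s \<le> m then s else s - m) mod r" for s
  have fin: "finite U" using U(1) finite_subset by blast
  have r: "r > 0" using U(2) fin by (simp add: r_def card_gt_0_iff)
  have n0: "n 0 = 0"
  proof -
    have "{u \<in> U. u \<le> 0} = {}" using U(1) by auto
    then show ?thesis unfolding n_def by (metis card.empty)
  qed
  have nm: "n m = r" unfolding n_def r_def by (rule arg_cong[where f=card]) (use U(1) in auto)
  have n_Suc: "n (Suc l) = n l" if "Suc l \<notin> U" for l
    unfolding n_def using that by (intro arg_cong[where f=card]) (auto simp: le_Suc_eq)
  have n_mono: "n l \<le> n l'" if "l \<le> l'" for l l'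
    unfolding n_def using that fin by (intro card_mono) auto
  have n_less: "n l < n l'" if "l < u" "u \<le> l'" "u \<in> U" for l l' u
    unfolding n_def
  proof (rule psubset_card_mono)
    have "{u \<in> U. u \<le> l} \<subseteq> {u \<in> U. u \<le> l'}" "u \<in> {u \<in> U. u \<le> l'}" "u \<notin> {u \<in> U. u \<le> l}"
      using that by auto
    then show "{u \<in> U. u \<le> l} \<subset> {u \<in> U. u \<le> l'}" by blast
  qed (use fin in simp)
  have c_low: "c l = n l mod r" if "l \<le> m" for l using that by (simp add: c_def)
  \<comment> \<open>For \<open>l = 0\<close> this is segment \<open>m\<close>, coloured through
    level \<open>m\<close>; the two readings agree modulo \<open>r\<close> because
    \<open>n m = r\<close> and \<open>n 0 = 0\<close>.\<close>
  have c_high: "c (m + l) = n l mod r" if "l \<le> m" for l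
    using that n0 nm by (cases "l = 0") (auto simp: c_def)
  \<comment> \<open>Being an equivalence, this spreads from the level \<open>l0\<close> of a cap
    both upwards and downwards.\<close>
  have step: "?K (m + l) = ?K l \<longleftrightarrow> ?K (m + Suc l) = ?K (Suc l)" if "l < m" for l
  proof (cases "Suc l \<in> U")
    case True
    then show ?thesis using ladder_cap[OF that, of U] by simp
  next
    case False
    show ?thesis unfolding ladder_swap[OF that False] by auto
  qed
  obtain u where u: "u \<in> U" using U(2) by blast
  then obtain l0 where l0: "u = Suc l0" "l0 < m" using U(1) by (cases u) auto
  have iff0: "l \<le> m \<Longrightarrow> ?K (m + l) = ?K l \<longleftrightarrow> ?K (m + 0) = ?K 0" for l
  proof (induction l)
    case (Suc l)
    then show ?case using step[of l] by simp
  qed simp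
  have across: "?K (m + l) = ?K l" if "l \<le> m" for l
    using iff0[OF that] iff0[of l0] ladder_cap(1)[of l0 m U] u l0 by auto
  have up: "?K (Suc l) = ?K l" if "l < m" "Suc l \<notin> U" for l
    using across[of l] ladder_swap(2)[of l m U] that by simp
  have level: "?K (l + d) = ?K l" if "l + d \<le> m" "n l = n (l + d)" for l d
    using that
  proof (induction d)
    case (Suc d)
    have "n l = n (l + d)" using n_mono[of l "l + d"] n_mono[of "l + d" "l + Suc d"] Suc.prems by auto
    moreover have "Suc (l + d) \<notin> U"
      using n_less[of l "Suc (l + d)" "l + Suc d"] Suc.prems by auto
    ultimately show ?case using Suc up[of "l + d"] by simp
  qed simp
  have level': "?K l = ?K l'" if "l \<le> m" "l' \<le> m" "n l = n l'" for l l'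
    using that level[of l "l' - l"] level[of l' "l - l'"] by (cases "l \<le> l'") auto
  have low: "?K l = ?K l'" if l: "l \<le> m" "l' \<le> m" and eq: "n l mod r = n l' mod r" for l l'
  proof -
    have le_r: "n k \<le> r" if "k \<le> m" for k using n_mono[OF that] nm by simp
    \<comment> \<open>Residue 0 belongs to both the lowest and the highest block;
      \<open>across\<close> at level 0 identifies segments \<open>m\<close> and 0.\<close>
    have top: "?K k = ?K 0" if "k \<le> m" "n k mod r = 0" for k
    proof -
      have "n k = 0 \<or> n k = r" using le_r[OF that(1)] that(2) r by (cases "n k = r") auto
      then have "?K k = ?K 0 \<or> ?K k = ?K m"
        using level'[of k 0] level'[of k m] n0 nm that(1) by auto
      moreover have "?K m = ?K 0" using across[of 0] by simp
      ultimately show ?thesis by auto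
    qed
    show ?thesis
    proof (cases "n l mod r = 0")
      case True
      then show ?thesis using top[of l] top[of l'] l eq by simp
    next
      case False
      then have "n l \<noteq> r" "n l' \<noteq> r" using eq by auto
      then have "n l < r" "n l' < r" using le_r[OF l(1)] le_r[OF l(2)] by auto
      then show ?thesis using level'[OF l] eq by simp
    qed
  qed
  have "card (?K ` {0..2 * m}) = card (c ` {0..2 * m})"
  proof (rule card_components_eq)
    fix x y assume "(x, y) \<in> ladder m U"
    then obtain i where i: "i \<in> {1..m}" "(x, y) \<in> rung m i (i \<notin> U)"
      by (auto simp: ladder_def)
    then obtain l where l: "i = Suc l" "l < m" by (cases i) auto
    have cl: "c l = n l mod r" "c (Suc l) = n (Suc l) mod r" "c (m + l) = n l mod r"
        "c (Suc (m + l)) = n (Suc l) mod r"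
      using l c_low c_high[of l] c_high[of "Suc l"] by auto
    show "c x = c y" using i(2) l n_Suc[of l] by (auto simp: rung_def cl split: if_splits)
  next
    fix x y assume xy: "x \<in> {0..2 * m}" "y \<in> {0..2 * m}" "c x = c y"
    have lev: "\<exists>l\<le>m. ?K s = ?K l \<and> c s = n l mod r" if "s \<in> {0..2 * m}" for s
    proof (cases "s \<le> m")
      case True
      then show ?thesis using c_low by blast
    next
      case False
      then show ?thesis using c_high[of "s - m"] across[of "s - m"] that
        by (intro exI[of _ "s - m"]) auto
    qed
    obtain l l' where "l \<le> m" "?K x = ?K l" "c x = n l mod r" "l' \<le> m" "?K y = ?K l'" "c y = n l' mod r"
      using lev[OF xy(1)] lev[OF xy(2)] by blast
    then show "?K x = ?K y" using low[of l l'] xy(3) by simp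
  qed
  also have "c ` {0..2 * m} = {0..<r}"
  proof
    show "c ` {0..2 * m} \<subseteq> {0..<r}" using r by (auto simp: c_def)
    have nU: "n ` U = {1..r}"
      using bij_betw_card_le[OF fin] unfolding n_def r_def bij_betw_def by simp
    show "{0..<r} \<subseteq> c ` {0..2 * m}"
    proof
      fix x assume x: "x \<in> {0..<r}"
      \<comment> \<open>On \<open>U\<close> the counter \<open>n\<close> takes exactly the values 1
        to \<open>r\<close>, so residue 0 is represented by \<open>r\<close>.\<close>
      define y where "y = (if x = 0 then r else x)"
      have y: "y \<in> {1..r}" "y mod r = x" using x r by (auto simp: y_def)
      from y(1) have "y \<in> n ` U" by (simp only: nU)
      then obtain u where "u \<in> U" "n u = y" by (elim imageE) simp
      moreover have "u \<le> m" using U(1) \<open>u \<in> U\<close> by auto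
      ultimately have "c u = x" "u \<in> {0..2 * m}" using c_low y(2) by auto
      then show "x \<in> c ` {0..2 * m}" by blast
    qed
  qed
  finally show ?thesis by (simp add: r_def)
qed

text \<open>For \<open>I\<close> inside (0,1) all tails precede all heads, in the same order.
  Indexing by a set of points keeps the family closed under deleting arrows.\<close>

definition parallel_arrows :: "real set \<Rightarrow> arrow set" where
  "parallel_arrows I = (\<lambda>x. (x, x + 1, True)) ` I"

lemma gauss_wf_parallel_arrows:
  assumes "finite I" "I \<subseteq> {0<..<1}"
  shows "gauss_wf (parallel_arrows I)"
proof -
  have "{x, x + 1} \<inter> {y, y + 1} = {}" if "x \<in> I" "y \<in> I" "x \<noteq> y" for x y
  proof -
    have "0 < x" "x < 1" "0 < y" "y < 1" using assms(2) that(1,2) by auto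
    then have "x \<noteq> y + 1" "y \<noteq> x + 1" by linarith+
    then show ?thesis using that(3) by auto
  qed
  then show ?thesis
    using assms(1) unfolding gauss_wf_def parallel_arrows_def arr_tail_def arr_head_def by simp
qed

lemma card_parallel_arrows: "card (parallel_arrows I) = card I"
  unfolding parallel_arrows_def by (rule card_image) (auto intro: inj_onI)

text \<open>If \<open>x\<close> has position \<open>lv x\<close> in \<open>I\<close>, its arrow has
  endpoint numbers \<open>lv x\<close> and \<open>m + lv x\<close>. The segment graph is thus the
  ladder with caps at the arrows outside \<open>R\<close>; the long component is subtracted.\<close>

lemma loops_parallel_arrows:
  assumes fin: "finite I" and I: "I \<subseteq> {0<..<1}" and R: "R \<subseteq> parallel_arrows I"
  shows "loops (parallel_arrows I) R =
    (if R = parallel_arrows I then card I mod 2 else card (parallel_arrows I - R) - 1)"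
proof -
  let ?G = "parallel_arrows I"
  let ?a = "\<lambda>x. (x, x + 1, True) :: arrow"
  define m where "m = card I"
  define lv where "lv x = card {y \<in> I. y \<le> x}" for x
  define U where "U = lv ` {x \<in> I. ?a x \<notin> R}"
  have bij: "bij_betw lv I {1..m}"
    unfolding lv_def m_def by (rule bij_betw_card_le[OF fin])
  have ep: "endpts ?G = I \<union> (\<lambda>x. x + 1) ` I"
    by (auto simp: endpts_def parallel_arrows_def arr_tail_def arr_head_def)
  have cardI1: "card ((\<lambda>x. x + 1) ` J) = card J" for J :: "real set"
    by (rule card_image) (auto intro: inj_onI)
  have lt: "x < y + 1" if "x \<in> I" "y \<in> I" for x y
  proof -
    have "x < 1" "0 < y" using I that by auto
    then show ?thesis by linarith
  qed
  have disj: "I \<inter> (\<lambda>x. x + 1) ` I = {}" using lt by (auto simp: less_le)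
  have card_ep: "card (endpts ?G) = 2 * m"
    unfolding ep using fin disj by (simp add: card_Un_disjoint cardI1 m_def)
  have lv_eq: "card {y \<in> I. y < x} + 1 = lv x" if "x \<in> I" for x
  proof -
    have "{y \<in> I. y \<le> x} = insert x {y \<in> I. y < x}" using that by auto
    then show ?thesis unfolding lv_def using fin by simp
  qed
  have rk_low: "rk ?G x = lv x" if "x \<in> I" for x
  proof -
    have "{y \<in> endpts ?G. y < x} = {y \<in> I. y < x}"
      using lt[OF that] by (auto simp: ep dest: less_asym)
    then show ?thesis using lv_eq[OF that] by (simp add: rk_def)
  qed
  have rk_high: "rk ?G (x + 1) = m + lv x" if "x \<in> I" for x
  proof -
    have "{y \<in> endpts ?G. y < x + 1} = I \<union> (\<lambda>x. x + 1) ` {y \<in> I. y < x}"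
      using lt[OF _ that] by (auto simp: ep)
    moreover have "I \<inter> (\<lambda>x. x + 1) ` {y \<in> I. y < x} = {}" using disj by blast
    ultimately show ?thesis using lv_eq[OF that] fin
      by (simp add: rk_def card_Un_disjoint cardI1 m_def)
  qed
  have lvU: "lv x \<in> U \<longleftrightarrow> ?a x \<notin> R" if "x \<in> I" for x
    unfolding U_def using inj_on_image_mem_iff[OF bij_betw_imp_inj_on[OF bij] that, of "{x \<in> I. ?a x \<notin> R}"] that
    by auto
  have lvI: "lv ` I = {1..m}" using bij by (simp add: bij_betw_def)
  have "(\<Union>a\<in>?G. smoothing_edges (rk ?G) a (a \<in> R)) = (\<Union>x\<in>I. rung m (lv x) (lv x \<notin> U))"
    unfolding parallel_arrows_def[of I] image_image
    unfolding parallel_arrows_def[of I, symmetric]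
  proof (intro SUP_cong refl)
    fix x assume x: "x \<in> I"
    have "min (lv x) (m + lv x) = lv x" "max (lv x) (m + lv x) = m + lv x" by auto
    then show "smoothing_edges (rk ?G) (?a x) (?a x \<in> R) = rung m (lv x) (lv x \<notin> U)"
      using x lvU[OF x] rk_low[OF x] rk_high[OF x]
      by (simp add: Let_def smoothing_edges_def rung_def arr_tail_def arr_head_def)
  qed
  also have "\<dots> = ladder m U" unfolding ladder_def lvI[symmetric] by (simp add: image_image)
  finally have edges: "(\<Union>a\<in>?G. smoothing_edges (rk ?G) a (a \<in> R)) = ladder m U" .
  have cardU: "card U = card (?G - R)"
  proof -
    have "?G - R = ?a ` {x \<in> I. ?a x \<notin> R}" by (auto simp: parallel_arrows_def)
    moreover have "card (?a ` {x \<in> I. ?a x \<notin> R}) = card {x \<in> I. ?a x \<notin> R}"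
      by (rule card_image) (auto intro: inj_onI)
    moreover have "card U = card {x \<in> I. ?a x \<notin> R}" unfolding U_def
      by (rule card_image) (rule inj_on_subset[OF bij_betw_imp_inj_on[OF bij]], auto)
    ultimately show ?thesis by simp
  qed
  have U_sub: "U \<subseteq> {1..m}" unfolding U_def using lvI by blast
  have U_empty: "U = {} \<longleftrightarrow> R = ?G"
    unfolding U_def using R by (auto simp: parallel_arrows_def)
  show ?thesis
  proof (cases "R = ?G")
    case True
    then show ?thesis
      unfolding loops_def n_loops_def n_components_component seg_edges_oriented edges card_ep
      using U_empty ladder_components_swaps[of m] by (simp add: m_def)
  next
    case False
    then show ?thesis
      unfolding loops_def n_loops_def n_components_component seg_edges_oriented edges card_ep
      using U_empty ladder_components_caps[OF U_sub] by (simp add: cardU)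
  qed
qed

text \<open>The extra \<open>d\<close> turns \<open>u - 1\<close> loops into \<open>d ^ u\<close>,
  absorbed by the \<open>u\<close> factors \<open>q\<close>, which leaves a binomial expansion. The
  all-oriented state deviates and gives the correction term. A general ring covers both power series
  and their constant terms.\<close>

lemma state_sum_parallel_arrows:
  fixes p q d :: "'a::comm_ring_1"
  assumes fin: "finite I" and I: "I \<subseteq> {0<..<1}"
  defines "G \<equiv> parallel_arrows I"
  shows "d * (\<Sum>R\<in>Pow G. (\<Prod>a\<in>G. if a \<in> R then p else q) * d ^ loops G R) =
    (p + q * d) ^ card I + p ^ card I * (d ^ (1 + card I mod 2) - 1)"
proof -
  have finG: "finite G" using fin by (simp add: G_def parallel_arrows_def)
  have cardG: "card G = card I" by (simp add: G_def card_parallel_arrows)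
  have term_eq: "d * ((\<Prod>a\<in>G. if a \<in> R then p else q) * d ^ loops G R) =
      (\<Prod>a\<in>R. p) * (\<Prod>a\<in>G - R. q * d) + (if R = G then p ^ card I * (d ^ (1 + card I mod 2) - 1) else 0)"
    if "R \<in> Pow G" for R
  proof -
    have R: "R \<subseteq> G" using that by simp
    have "(\<Prod>a\<in>G. if a \<in> R then p else q) = (\<Prod>a\<in>G - R. if a \<in> R then p else q) * (\<Prod>a\<in>R. if a \<in> R then p else q)"
      by (rule prod.subset_diff[OF R finG])
    then have pr: "(\<Prod>a\<in>G. if a \<in> R then p else q) = q ^ card (G - R) * p ^ card R" by simp
    have lp: "loops G R = (if R = G then card I mod 2 else card (G - R) - 1)"
      using loops_parallel_arrows[OF fin I] R by (simp add: G_def)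
    show ?thesis
    proof (cases "R = G")
      case True
      then show ?thesis unfolding pr lp by (simp add: cardG algebra_simps)
    next
      case False
      then have "card (G - R) > 0" using R finG by (subst card_gt_0_iff) auto
      then obtain n where "card (G - R) = Suc n" using gr0_implies_Suc by blast
      then show ?thesis
        unfolding pr lp using False by (simp add: power_mult_distrib mult_ac)
    qed
  qed
  have "d * (\<Sum>R\<in>Pow G. (\<Prod>a\<in>G. if a \<in> R then p else q) * d ^ loops G R) =
     (\<Sum>R\<in>Pow G. (\<Prod>a\<in>R. p) * (\<Prod>a\<in>G - R. q * d)) +
     (\<Sum>R\<in>Pow G. if R = G then p ^ card I * (d ^ (1 + card I mod 2) - 1) else 0)"
    unfolding sum_distrib_left sum.distrib[symmetric] by (rule sum.cong[OF refl term_eq])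
  also have "(\<Sum>R\<in>Pow G. (\<Prod>a\<in>R. p) * (\<Prod>a\<in>G - R. q * d)) = (p + q * d) ^ card I"
    unfolding prod_add[OF finG, symmetric] by (simp add: cardG)
  also have "(\<Sum>R\<in>Pow G. if R = G then p ^ card I * (d ^ (1 + card I mod 2) - 1) else 0) =
      p ^ card I * (d ^ (1 + card I mod 2) - 1)"
    using finG by (subst sum.delta) auto
  finally show ?thesis .
qed

section \<open>The state sum of parallel arrows, in full and at leading order\<close>

lemma arr_sign_parallel_arrows: "a \<in> parallel_arrows I \<Longrightarrow> arr_sign a"
  by (auto simp: parallel_arrows_def arr_sign_def)

lemma jk_series_parallel_arrows:
  assumes "finite I" "I \<subseteq> {0<..<1}"
  shows "loop_val * jk_series (parallel_arrows I) =
    fps_exp (-6 * real (card I)) +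
    (-1) ^ card I * fps_exp (-2 * real (card I)) * (loop_val ^ (1 + card I mod 2) - 1)"
proof -
  \<comment> \<open>One of the two exponentials in the product cancels the oriented weight.\<close>
  have base: "wt True True + wt True False * loop_val = fps_exp (-6)"
    by (simp add: wt_def loop_val_def wt_exponent_def algebra_simps flip: fps_exp_add_mult)
  have pow: "wt True True ^ n = (-1) ^ n * fps_exp (-2 * real n)" for n
    by (simp add: wt_def wt_exponent_def power_minus[of "fps_exp (- 2)"] fps_exp_power_mult mult.commute)
  have "jk_series (parallel_arrows I) = (\<Sum>R\<in>Pow (parallel_arrows I).
      (\<Prod>a\<in>parallel_arrows I. if a \<in> R then wt True True else wt True False)
        * loop_val ^ loops (parallel_arrows I) R)"
    unfolding jk_series_def
    by (intro sum.cong refl arg_cong2[where f="(*)"] prod.cong) (auto simp: arr_sign_parallel_arrows)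
  then show ?thesis
    using state_sum_parallel_arrows[OF assms, of loop_val "wt True True" "wt True False"]
    unfolding base pow fps_exp_power_mult by (simp add: mult.commute)
qed

lemma alt_quot_parallel_arrows_nonzero:
  assumes "finite I" "I \<subseteq> {0<..<1}" and card: "card I \<ge> 2"
  shows "fps_nth (alt_quot (parallel_arrows I) (parallel_arrows I)) 0 \<noteq> 0"
proof -
  let ?G = "parallel_arrows I"
  have q: "fps_nth (jump_quot True r) 0 = (if r then 4 else 8)" for r
    by (simp add: jump_quot_def wt_def wt_exponent_def)
  have d: "fps_nth loop_val 0 = -2" by (simp add: loop_val_def)
  \<comment> \<open>Taking constant terms is multiplicative, so the state sum applies with the
    numbers 4, 8 and -2.\<close>
  have hom_prod: "fps_nth (\<Prod>a\<in>A. F a) 0 = (\<Prod>a\<in>A. fps_nth (F a) 0)" for A and F :: "arrow \<Rightarrow> real fps"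
    by (induction A rule: infinite_finite_induct) auto
  have "fps_nth (alt_quot ?G ?G) 0 =
      (\<Sum>R\<in>Pow ?G. (\<Prod>a\<in>?G. if a \<in> R then 4 else 8) * (-2) ^ loops ?G R)"
    unfolding alt_quot_def fps_sum_nth
    by (intro sum.cong refl)
      (simp add: hom_prod fps_power_zeroth d q arr_sign_parallel_arrows cong: prod.cong)
  then have eq: "-2 * fps_nth (alt_quot ?G ?G) 0 =
      (-12) ^ card I + 4 ^ card I * ((-2) ^ (1 + card I mod 2) - 1)"
    using state_sum_parallel_arrows[OF assms(1,2), of "-2::real" 4 8] by simp
  have "(3::real) ^ 2 \<le> 3 ^ card I" using card by (intro power_increasing) auto
  then have pos: "(3::real) ^ card I - 3 > 0" by simp
  have "(-12::real) ^ card I = (-1) ^ card I * 4 ^ card I * 3 ^ card I"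
    by (simp flip: power_mult_distrib)
  then have "-2 * fps_nth (alt_quot ?G ?G) 0 = (-1) ^ card I * 4 ^ card I * (3 ^ card I - 3)"
    unfolding eq by (cases "even (card I)") (auto simp: mod_2_eq_odd algebra_simps)
  then show ?thesis using pos by auto
qed

section \<open>Non-polynomiality\<close>

text \<open>The induction hypothesis is applied to both \<open>f\<close> and \<open>fdiff f\<close>,
  hence \<open>arbitrary: f\<close>; Pascal's rule combines the two sums.\<close>

lemma newton_forward:
  "f (z + int n) = (\<Sum>i\<le>n. real (n choose i) * (fdiff ^^ i) f z)"
proof (induction n arbitrary: f)
  case (Suc n)
  let ?D = "\<lambda>i. (fdiff ^^ i) f z"
  have "f (z + int (Suc n)) = f (z + int n) + fdiff f (z + int n)"
    by (simp add: fdiff_def algebra_simps)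
  also have "fdiff f (z + int n) = (\<Sum>i\<le>n. real (n choose i) * ?D (Suc i))"
    by (subst Suc.IH) (simp add: funpow_Suc_right del: funpow.simps)
  also have "f (z + int n) = (\<Sum>i\<le>Suc n. real (n choose i) * ?D i)"
    by (subst Suc.IH) simp
  also have "\<dots> = ?D 0 + (\<Sum>i\<le>n. real (n choose Suc i) * ?D (Suc i))"
    by (subst sum.atMost_Suc_shift) simp
  also have "\<dots> + (\<Sum>i\<le>n. real (n choose i) * ?D (Suc i)) =
      ?D 0 + (\<Sum>i\<le>n. real (Suc n choose Suc i) * ?D (Suc i))"
    by (simp add: sum.distrib algebra_simps del: funpow.simps)
  also have "\<dots> = (\<Sum>i\<le>Suc n. real (Suc n choose i) * ?D i)"
    by (subst sum.atMost_Suc_shift) simp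
  finally show ?case .
qed simp

lemma fdiff_zero_imp_poly:
  assumes "\<And>i. i > N \<Longrightarrow> (fdiff ^^ i) f 0 = 0"
  shows "\<exists>r. \<forall>n. f (int n) = poly r (real n)"
proof -
  define b :: "nat \<Rightarrow> real poly" where
    "b i = smult (1 / fact i) (\<Prod>j\<in>{0..<i}. [:- real j, 1:])" for i
  have b: "poly (b i) (real n) = real (n choose i)" for i n
    by (simp add: b_def poly_prod binomial_gbinomial gbinomial_prod_rev)
  have "f (int n) = poly (\<Sum>i\<le>N. smult ((fdiff ^^ i) f 0) (b i)) (real n)" for n
  proof -
    have "f (int n) = (\<Sum>i\<le>n. real (n choose i) * (fdiff ^^ i) f 0)"
      using newton_forward[of f 0 n] by simp
    \<comment> \<open>Terms beyond \<open>n\<close> vanish by the binomial coefficient, terms beyond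
      \<open>N\<close> by hypothesis; this makes the range independent of \<open>n\<close>.\<close>
    also have "\<dots> = (\<Sum>i\<le>max n N. real (n choose i) * (fdiff ^^ i) f 0)"
      by (rule sum.mono_neutral_left) (auto simp: binomial_eq_0)
    also have "\<dots> = (\<Sum>i\<le>N. real (n choose i) * (fdiff ^^ i) f 0)"
      by (rule sum.mono_neutral_right) (use assms in auto)
    finally show ?thesis by (simp add: poly_sum b mult.commute)
  qed
  then show ?thesis by blast
qed

text \<open>Summing over the two choices for one further element replaces \<open>g\<close> by
  \<open>fdiff g\<close>. With \<open>z = 0\<close> the argument of \<open>g\<close> is the number
  of elements left after removing \<open>T\<close>.\<close>

lemma alternating_subset_sum_fdiff:
  assumes "finite S"
  shows "(\<Sum>T\<in>Pow S. (-1) ^ card T * g (z + int (card S) - int (card T))) = (fdiff ^^ card S) g z"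
  using assms
proof (induction S arbitrary: g rule: finite_induct)
  case (insert x S)
  let ?c = "int (card S)"
  have "(\<Sum>T\<in>Pow (insert x S). (-1) ^ card T * g (z + int (card (insert x S)) - int (card T))) =
      (\<Sum>T\<in>Pow S. (-1) ^ card T * g (z + (1 + ?c) - int (card T))) +
      (\<Sum>T\<in>insert x ` Pow S. (-1) ^ card T * g (z + (1 + ?c) - int (card T)))"
    unfolding Pow_insert using insert.hyps by (subst sum.union_disjoint) auto
  also have "(\<Sum>T\<in>insert x ` Pow S. (-1) ^ card T * g (z + (1 + ?c) - int (card T))) =
      (\<Sum>T\<in>Pow S. (-1) ^ card (insert x T) * g (z + (1 + ?c) - int (card (insert x T))))"
    using insert.hyps by (subst sum.reindex) (auto intro!: inj_onI simp: o_def)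
  also have "\<dots> = (\<Sum>T\<in>Pow S. - ((-1) ^ card T * g (z + ?c - int (card T))))"
  proof (rule sum.cong[OF refl])
    fix T assume "T \<in> Pow S"
    then have "card (insert x T) = Suc (card T)"
      using insert.hyps finite_subset by (subst card_insert_disjoint) auto
    then show "(-1) ^ card (insert x T) * g (z + (1 + ?c) - int (card (insert x T))) =
        - ((-1) ^ card T * g (z + ?c - int (card T)))"
      by (simp add: algebra_simps)
  qed
  also have "(\<Sum>T\<in>Pow S. (-1) ^ card T * g (z + (1 + ?c) - int (card T))) + \<dots> =
      (\<Sum>T\<in>Pow S. (-1) ^ card T * fdiff g (z + ?c - int (card T)))"
    unfolding sum.distrib[symmetric] by (intro sum.cong refl) (simp add: fdiff_def algebra_simps)
  also have "\<dots> = (fdiff ^^ card S) (fdiff g) z" by (rule insert.IH)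
  finally show ?case using insert.hyps by (simp add: funpow_Suc_right del: funpow.simps)
qed simp

section \<open>Coefficients of exponential series as polynomials in the exponent\<close>

definition exp_coeff_poly :: "nat \<Rightarrow> real fps \<Rightarrow> real \<Rightarrow> real poly" where
  "exp_coeff_poly k F c = (\<Sum>i\<le>k. monom (c ^ i / fact i * fps_nth F (k - i)) i)"

lemma poly_exp_coeff_poly:
  "poly (exp_coeff_poly k F c) x = fps_nth (fps_exp (c * x) * F) k"
  unfolding exp_coeff_poly_def fps_mult_nth poly_sum atMost_atLeast0
  by (intro sum.cong) (simp_all add: poly_monom power_mult_distrib)

lemma coeff_exp_coeff_poly:
  "i \<le> k \<Longrightarrow> coeff (exp_coeff_poly k F c) i = c ^ i / fact i * fps_nth F (k - i)"
  unfolding exp_coeff_poly_def by (simp add: coeff_sum)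

lemma poly_eq_if_eq_at_nats:
  fixes p q :: "real poly"
  assumes "inj g" "\<And>n::nat. poly p (real (g n)) = poly q (real (g n))"
  shows "p = q"
proof (rule ccontr)
  assume "p \<noteq> q"
  then have "finite {x. poly (p - q) x = 0}" by (intro poly_roots_finite) simp
  moreover have "range (\<lambda>n. real (g n)) \<subseteq> {x. poly (p - q) x = 0}" using assms(2) by auto
  moreover have "infinite (range (\<lambda>n. real (g n)))"
    using assms(1) by (intro range_inj_infinite) (auto simp: inj_def)
  ultimately show False using finite_subset by blast
qed

section \<open>The twist family and its two parity classes\<close>

definition twist_points :: "nat \<Rightarrow> real set" where
  "twist_points m = (\<lambda>i. real i / (real m + 1)) ` {1..m}"

lemma twist_points:
  "finite (twist_points m)" "twist_points m \<subseteq> {0<..<1}" "card (twist_points m) = m"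
proof -
  show "finite (twist_points m)" by (simp add: twist_points_def)
  show "twist_points m \<subseteq> {0<..<1}" by (auto simp: twist_points_def field_simps)
  have "inj_on (\<lambda>i. real i / (real m + 1)) {1..m}" by (auto intro!: inj_onI simp: field_simps)
  then show "card (twist_points m) = m" unfolding twist_points_def by (subst card_image) auto
qed

text \<open>The closed formula sees only the number of arrows, and \<open>loop_val\<close> can be
  cancelled. Needed because deleting arrows leaves unevenly spaced points.\<close>

lemma vk_parallel_arrows_card:
  assumes "finite I" "I \<subseteq> {0<..<1}"
  shows "vk k (parallel_arrows I) = vk k (parallel_arrows (twist_points (card I)))"
proof -
  have nz: "loop_val \<noteq> 0"
  proof
    assume "loop_val = 0"
    then have "fps_nth loop_val 0 = 0" by simp
    then show False by (simp add: loop_val_def)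
  qed
  have "loop_val * jk_series (parallel_arrows I) = loop_val * jk_series (parallel_arrows (twist_points (card I)))"
    unfolding jk_series_parallel_arrows[OF assms] jk_series_parallel_arrows[OF twist_points(1,2)] twist_points(3) ..
  then have "jk_series (parallel_arrows I) = jk_series (parallel_arrows (twist_points (card I)))"
    using nz by simp
  moreover have "finite (parallel_arrows I)" "finite (parallel_arrows (twist_points (card I)))"
    using assms(1) twist_points(1) by (simp_all add: parallel_arrows_def)
  ultimately show ?thesis by (simp add: vk_eq_jk_series)
qed

lemma vk_twist_not_poly:
  assumes "k \<ge> 2"
  shows "\<not> (\<exists>r. \<forall>m. vk k (parallel_arrows (twist_points m)) = poly r (real m))"
proof
  assume "\<exists>r. \<forall>m. vk k (parallel_arrows (twist_points m)) = poly r (real m)"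
  then obtain r where r: "vk k (parallel_arrows (twist_points m)) = poly r (real m)" for m by blast
  define L where "L = inverse loop_val"
  have d0: "fps_nth loop_val 0 = -2" by (simp add: loop_val_def)
  have L: "L * loop_val = 1" unfolding L_def using d0 by (intro inverse_mult_eq_1) simp
  have vk: "vk k (parallel_arrows (twist_points m)) = fps_nth (fps_exp (-6 * real m) * L +
      (-1) ^ m * (fps_exp (-2 * real m) * (L * (loop_val ^ (1 + m mod 2) - 1)))) k" for m
  proof -
    have "jk_series (parallel_arrows (twist_points m)) = L * (loop_val * jk_series (parallel_arrows (twist_points m)))"
      using L by (simp flip: mult.assoc)
    also have "\<dots> = fps_exp (-6 * real m) * L +
      (-1) ^ m * (fps_exp (-2 * real m) * (L * (loop_val ^ (1 + m mod 2) - 1)))"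
      unfolding jk_series_parallel_arrows[OF twist_points(1,2)] twist_points(3)
      by (simp add: distrib_left mult_ac)
    finally show ?thesis
      using twist_points(1) by (simp add: vk_eq_jk_series parallel_arrows_def)
  qed
  note r_values = trans[OF r[symmetric] vk]
  have even: "r = exp_coeff_poly k L (-6) + exp_coeff_poly k (L * (loop_val - 1)) (-2)"
  proof (rule poly_eq_if_eq_at_nats[where g="\<lambda>n. 2 * n"])
    fix n show "poly r (real (2 * n)) =
      poly (exp_coeff_poly k L (-6) + exp_coeff_poly k (L * (loop_val - 1)) (-2)) (real (2 * n))"
      unfolding r_values poly_add poly_exp_coeff_poly fps_add_nth by simp
  qed (simp add: inj_def)
  have odd: "r = exp_coeff_poly k L (-6) - exp_coeff_poly k (L * (loop_val\<^sup>2 - 1)) (-2)"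
  proof (rule poly_eq_if_eq_at_nats[where g="\<lambda>n. Suc (2 * n)"])
    fix n show "poly r (real (Suc (2 * n))) =
      poly (exp_coeff_poly k L (-6) - exp_coeff_poly k (L * (loop_val\<^sup>2 - 1)) (-2)) (real (Suc (2 * n)))"
      unfolding r_values poly_diff poly_exp_coeff_poly fps_add_nth by (simp add: power2_eq_square)
  qed (simp add: inj_def)
  have "exp_coeff_poly k (L * (loop_val - 1)) (-2) + exp_coeff_poly k (L * (loop_val\<^sup>2 - 1)) (-2) = 0"
    using even odd by (simp add: algebra_simps)
  \<comment> \<open>Degree \<open>k - 2\<close> picks out the series coefficient at 2, the first
    nonzero one of \<open>L * (loop_val\<^sup>2 + loop_val - 2)\<close>; this is where
    \<open>k \<ge> 2\<close> enters.\<close>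
  then have "coeff (exp_coeff_poly k (L * (loop_val - 1)) (-2)) (k - 2) +
      coeff (exp_coeff_poly k (L * (loop_val\<^sup>2 - 1)) (-2)) (k - 2) = 0"
    by (metis coeff_0 coeff_add)
  then have "(-2) ^ (k - 2) / fact (k - 2) *
      (fps_nth (L * (loop_val - 1)) 2 + fps_nth (L * (loop_val\<^sup>2 - 1)) 2) = 0"
    using assms by (simp add: coeff_exp_coeff_poly distrib_left)
  then have "fps_nth (L * (loop_val - 1)) 2 + fps_nth (L * (loop_val\<^sup>2 - 1)) 2 = 0" by simp
  then have "fps_nth (L * (loop_val\<^sup>2 + loop_val - 2)) 2 = 0"
    by (simp only: fps_add_nth[symmetric]) (simp add: algebra_simps)
  moreover have "fps_nth (L * (loop_val\<^sup>2 + loop_val - 2)) 2 = -6"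
  proof -
    have d1: "fps_nth loop_val (Suc 0) = 0" "fps_nth loop_val 2 = -4"
      by (simp_all add: loop_val_def)
    have L0: "fps_nth L 0 = -1/2" by (simp add: L_def d0)
    have M: "fps_nth (loop_val\<^sup>2 + loop_val - 2) 0 = 0" "fps_nth (loop_val\<^sup>2 + loop_val - 2) (Suc 0) = 0"
      "fps_nth (loop_val\<^sup>2 + loop_val - 2) 2 = 12"
      by (simp_all add: power2_eq_square fps_mult_nth numeral_2_eq_2 d0 d1 d1[unfolded numeral_2_eq_2] fps_numeral_nth)
    show ?thesis
      unfolding fps_mult_nth[of L] using M L0 by (simp add: numeral_2_eq_2)
  qed
  ultimately show False by simp
qed

section \<open>Kauffman degree, GPV type and the twist sequence\<close>

lemma kauff_ft_deg_vk:
  assumes "k \<ge> 2"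
  shows "kauff_ft_deg (vk k) k"
proof -
  have "kauff_ft_le (vk k) k"
    unfolding kauff_ft_le_def by (auto simp: vk_alternating_sum)
  moreover have "\<not> kauff_ft_le (vk k) (k - 1)"
  proof
    \<comment> \<open>All \<open>k\<close> crossings are made singular, so the alternating sum is
      the constant term of \<open>alt_quot\<close>.\<close>
    let ?G = "parallel_arrows (twist_points k)"
    assume le: "kauff_ft_le (vk k) (k - 1)"
    have wf: "gauss_wf ?G" by (rule gauss_wf_parallel_arrows[OF twist_points(1,2)])
    have card: "card ?G = k" by (simp add: card_parallel_arrows twist_points)
    have "(\<Sum>T\<in>Pow ?G. (-1) ^ card T * vk k (flip T ?G)) = 0"
      by (rule le[unfolded kauff_ft_le_def, rule_format, OF wf subset_refl]) (use card assms in simp)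
    then show False
      using alt_quot_parallel_arrows_nonzero[OF twist_points(1,2), of k] assms
      by (simp add: vk_alternating_sum[OF wf] card twist_points(3))
  qed
  ultimately show ?thesis by (simp add: kauff_ft_deg_def)
qed

lemma not_gpv_ft_le_vk:
  assumes "k \<ge> 2"
  shows "\<not> gpv_ft_le (vk k) n"
proof
  assume gpv: "gpv_ft_le (vk k) n"
  \<comment> \<open>Differences at 0 evaluate \<open>f\<close> only at nonnegative integers, where
    \<open>nat\<close> loses nothing.\<close>
  define f where "f z = vk k (parallel_arrows (twist_points (nat z)))" for z
  have "(fdiff ^^ N) f 0 = 0" if N: "N > n" for N
  proof -
    let ?G = "parallel_arrows (twist_points N)"
    have wf: "gauss_wf ?G" by (rule gauss_wf_parallel_arrows[OF twist_points(1,2)])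
    have card: "card ?G = N" by (simp add: card_parallel_arrows twist_points)
    have fin: "finite ?G" using wf by (simp add: gauss_wf_def)
    have "vk k (?G - T) = f (0 + int (card ?G) - int (card T))" if T: "T \<in> Pow ?G" for T
    proof -
      define I where "I = {x \<in> twist_points N. (x, x + 1, True) \<notin> T}"
      have I: "finite I" "I \<subseteq> {0<..<1}" using twist_points(1,2)[of N] by (auto simp: I_def)
      have G: "?G - T = parallel_arrows I" by (auto simp: I_def parallel_arrows_def)
      have "card I = card (?G - T)" by (simp add: G card_parallel_arrows)
      also have "\<dots> = N - card T" using T fin card by (subst card_Diff_subset) (auto intro: finite_subset)
      also have "\<dots> = nat (0 + int (card ?G) - int (card T))" by (simp add: card)
      finally show ?thesis unfolding G f_def using vk_parallel_arrows_card[OF I] by simp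
    qed
    then have "(fdiff ^^ card ?G) f 0 = (\<Sum>T\<in>Pow ?G. (-1) ^ card T * vk k (?G - T))"
      by (simp add: alternating_subset_sum_fdiff[OF fin, symmetric])
    also have "\<dots> = 0" using gpv wf N card unfolding gpv_ft_le_def by simp
    finally show ?thesis by (simp add: card)
  qed
  then obtain r where "f (int m) = poly r (real m)" for m using fdiff_zero_imp_poly by blast
  then show False using vk_twist_not_poly[OF assms] by (auto simp: f_def)
qed

text \<open>Type FSR over the empty diagram, with intervals (0,1) and (1,2); its nonnegative half is
  the family of parallel arrows.\<close>

definition parallel_twist :: "int \<Rightarrow> arrow set" where
  "parallel_twist z = twist_arrows TwS TwR (z \<ge> 0) (nat \<bar>z\<bar>)
     (\<lambda>i. real i / (real (nat \<bar>z\<bar>) + 1)) (\<lambda>i. real i / (real (nat \<bar>z\<bar>) + 1) + 1)"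

lemma parallel_twist_int: "parallel_twist (int m) = parallel_arrows (twist_points m)"
  by (simp add: parallel_twist_def twist_arrows_def parallel_arrows_def twist_points_def image_image Let_def)

lemma frac_twist_seq_parallel_twist: "frac_twist_seq parallel_twist"
  unfolding frac_twist_seq_def
proof (intro exI conjI allI)
  show "gauss_wf {}" by (simp add: gauss_wf_def)
  show "proper_pair {} {0<..<1} {1<..<2}"
    unfolding proper_pair_def
    by (intro conjI exI[of _ 0] exI[of _ 1] exI[of _ 1] exI[of _ 2]) simp_all
  show "endpts {} \<inter> ({0<..<1} \<union> {1<..<2}) = {}" by (simp add: endpts_def)
  fix z :: int
  let ?m = "nat \<bar>z\<bar>"
  let ?a = "\<lambda>i. real i / (real ?m + 1)"
  show "strict_mono_on {1..?m} ?a" "strict_mono_on {1..?m} (\<lambda>i. ?a i + 1)"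
    by (auto simp: strict_mono_on_def divide_strict_right_mono)
  show sub: "?a ` {1..?m} \<subseteq> {0<..<1}"
    using twist_points(2) unfolding twist_points_def .
  then show "(\<lambda>i. ?a i + 1) ` {1..?m} \<subseteq> {1<..<2}" by fastforce
  show "parallel_twist z = {} \<union> twist_arrows TwS TwR (z \<ge> 0) ?m ?a (\<lambda>i. ?a i + 1)"
    by (simp add: parallel_twist_def)
qed

theorem theorem2:
  fixes k :: nat
  assumes "k \<ge> 2"
  shows "kauff_ft_deg (vk k) k \<and> (\<forall>n. \<not> gpv_ft_le (vk k) n) \<and>
         (\<exists>\<Phi>. frac_twist_seq \<Phi> \<and> \<not> (\<exists>n. poly_deg_le (\<lambda>z. vk k (\<Phi> z)) n))"
proof (intro conjI allI exI)
  show "kauff_ft_deg (vk k) k" by (rule kauff_ft_deg_vk[OF assms])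
  show "\<not> gpv_ft_le (vk k) n" for n by (rule not_gpv_ft_le_vk[OF assms])
  show "frac_twist_seq parallel_twist" by (rule frac_twist_seq_parallel_twist)
  show "\<not> (\<exists>n. poly_deg_le (\<lambda>z. vk k (parallel_twist z)) n)"
  proof
    assume "\<exists>n. poly_deg_le (\<lambda>z. vk k (parallel_twist z)) n"
    then obtain n where n: "poly_deg_le (\<lambda>z. vk k (parallel_twist z)) n" ..
    then obtain r where "vk k (parallel_twist (int m)) = poly r (real m)" for m
      using fdiff_zero_imp_poly[of n "\<lambda>z. vk k (parallel_twist z)"] unfolding poly_deg_le_def by blast
    then show False using vk_twist_not_poly[OF assms] by (auto simp: parallel_twist_int)
  qed
qed

end
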